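(* Let $n$ be a positive integer and let $p$ be a prime such that $p>\max(n+1,3)$. If $n$ is odd, then $$\sum_{0<k_1<\cdots<k_{n}<p}\left(\frac{p-k_{n}}{3}\right)\frac{(-1)^{k_{n}}}{k_1\cdots k_{n}}\equiv -\frac{2^{n+1}+2}{6^{n+1}}\,p\,B_{p-n-1}\left(\frac13\right)\pmod{p^2},$$ and if $n$ is even, then $$\sum_{0<k_1<\cdots<k_{n}<p}\left(\frac{p-k_{n}}{3}\right)\frac{(-1)^{k_{n}}}{k_1\cdots k_{n}}\equiv -\frac{2^{n+1}+4}{n6^n}\,B_{p-n}\left(\frac13\right)\pmod{p}.$$
   Context: The sums run over integers $k_1<\cdots<k_n$ with $0<k_1$ and $k_n<p$. $\left(\frac{\cdot}{3}\right)$ is the Legendre symbol modulo $3$: $\left(\frac{k}{3}\right)=0,1,-1$ according as $k\equiv 0,1,2\pmod 3$. $B_m(x)$ denotes the $m$-th Bernoulli polynomial, defined by $\frac{te^{xt}}{e^t-1}=\sum_{m\ge 0}B_m(x)\frac{t^m}{m!}$. Congruences are between rational numbers whose denominators are prime to $p$: $x\equiv y\pmod{p^s}$ means that $(x-y)/p^s$ has denominator not divisible by $p$. *)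

theory Defs
  imports
    "HOL-Computational_Algebra.Computational_Algebra"
    "HOL-Number_Theory.Number_Theory"
begin

text \<open>
  The Bernoulli polynomial \<open>B\<^sub>m(x)\<close>, evaluated at \<open>x\<close>, read off from its exponential
  generating function \<open>t e\<^sup>x\<^sup>t / (e\<^sup>t - 1)\<close>. The denominator has subdegree 1, so the quotient
  of formal power series is exact.
\<close>

definition bernoulli_gf :: "'a :: field_char_0 \<Rightarrow> 'a fps" where
  "bernoulli_gf x = fps_X * fps_exp x / (fps_exp 1 - 1)"

definition bernoulli_poly :: "nat \<Rightarrow> 'a :: field_char_0 \<Rightarrow> 'a" where
  "bernoulli_poly m x = fact m * fps_nth (bernoulli_gf x) m"

lemma bernoulli_gf_times: "bernoulli_gf x * (fps_exp 1 - 1) = fps_X * fps_exp x"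
proof -
  have nz: "fps_exp 1 - 1 \<noteq> (0 :: 'a fps)"
  proof
    assume "fps_exp 1 - 1 = (0 :: 'a fps)"
    hence "fps_nth (fps_exp 1 - 1 :: 'a fps) 1 = 0" by simp
    thus False by simp
  qed
  have "subdegree (fps_exp 1 - 1 :: 'a fps) \<le> 1"
    by (rule subdegree_leI) simp
  also have "\<dots> \<le> subdegree (fps_X * fps_exp x)"
    by (rule subdegree_geI) auto
  finally have "fps_exp 1 - 1 dvd fps_X * fps_exp x"
    using nz by (subst fps_dvd_iff) auto
  thus ?thesis
    unfolding bernoulli_gf_def by (rule dvd_div_mult_self)
qed

text \<open>\<open>quotient_of\<close> returns the fraction in lowest terms with positive denominator.\<close>

definition p_integral :: "nat \<Rightarrow> rat \<Rightarrow> bool" where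
  "p_integral p x \<longleftrightarrow> \<not> int p dvd snd (quotient_of x)"

text \<open>
  Congruence modulo \<open>p\<^sup>s\<close>. Both sides are required to have denominators prime to \<open>p\<close>:
  congruence is a relation between such rationals only.
\<close>

definition rat_cong_pow :: "nat \<Rightarrow> nat \<Rightarrow> rat \<Rightarrow> rat \<Rightarrow> bool" where
  "rat_cong_pow p s x y \<longleftrightarrow>
     p_integral p x \<and> p_integral p y \<and> p_integral p ((x - y) / of_nat p ^ s)"

text \<open>The tuples \<open>0 < k\<^sub>1 < \<dots> < k\<^sub>n < p\<close>, as lists; so \<open>k\<^sub>n\<close> is the last entry.\<close>

definition incr_tuples :: "nat \<Rightarrow> nat \<Rightarrow> nat list set" where
  "incr_tuples n p = {ks. length ks = n \<and> sorted_wrt (<) ks \<and> set ks \<subseteq> {0<..<p}}"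

lemma finite_incr_tuples: "finite (incr_tuples n p)"
  by (rule finite_subset[OF _ finite_lists_length_eq[of "{0<..<p}" n]])
     (auto simp: incr_tuples_def)

definition legendre_sum :: "nat \<Rightarrow> nat \<Rightarrow> rat" where
  "legendre_sum n p =
     (\<Sum>ks\<in>incr_tuples n p.
        of_int (Legendre (int p - int (last ks)) 3) *
        ((-1) ^ last ks / (\<Prod>k\<leftarrow>ks. of_nat k)))"

lemma Legendre_3:
  "Legendre k 3 = (if k mod 3 = 0 then 0 else if k mod 3 = 1 then 1 else -1)"
proof -
  have k: "k mod 3 = 0 \<or> k mod 3 = 1 \<or> k mod 3 = 2" by presburger
  have sq: "y\<^sup>2 mod 3 \<noteq> 2" for y :: int
  proof -
    have "y mod 3 = 0 \<or> y mod 3 = 1 \<or> y mod 3 = 2" by presburger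
    hence "(y mod 3)\<^sup>2 mod 3 \<noteq> 2" by auto
    thus ?thesis by (simp add: power_mod)
  qed
  have "QuadRes 3 k" if "k mod 3 = 1"
    unfolding QuadRes_def using that by (intro exI[of _ 1]) (simp add: cong_def)
  moreover have "\<not> QuadRes 3 k" if "k mod 3 = 2"
    unfolding QuadRes_def cong_def using that sq by auto
  ultimately show ?thesis
    using k by (auto simp: Legendre_def cong_def)
qed

end

theory Submission
  imports Defs
begin

hide_const (open) up_ring.coeff up_ring.monom module.smult

text \<open>
  Write \<open>\<chi>\<close> for the Legendre symbol modulo 3. Summing over the last index \<open>k = k\<^sub>n\<close>, the left-hand side
  is \<open>(-1)\<^sup>n\<close> times the coefficient \<open>g\<^sub>n\<close> of \<open>s\<^sup>n\<close> in \<open>G(s) = \<Sum>\<^sub>k \<chi>(p - k) binom(s, k)\<close>, \<open>0 \<le> k < p\<close>.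
  Since \<open>\<chi>(x) + \<chi>(x+1) + \<chi>(x+2) = 0\<close>, one has \<open>G(s) = (-1)\<^sup>s \<chi>(p + s)\<close> for the integers
  \<open>0 \<le> s \<le> p\<close>.

  These values are symmetric under \<open>s \<mapsto> p - s\<close>, so \<open>G(p - s) = G(s)\<close> as polynomials, and comparing
  coefficients modulo \<open>p\<^sup>2\<close> gives \<open>2 g\<^sub>n \<equiv> -(n+1) p g\<^sub>n\<^sub>+\<^sub>1\<close> for odd \<open>n\<close>, which reduces the odd case to
  the even one. For even \<open>n\<close>, orthogonality of powers modulo \<open>p\<close> gives
  \<open>g\<^sub>n \<equiv> - \<Sum>\<^sub>s G(s) s\<^sup>r\<close> with \<open>r = p - 1 - n\<close>, \<open>0 \<le> s < p\<close>. As \<open>G(s)\<close> is 6-periodic in \<open>s\<close>, this power sum is a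
  combination of the values \<open>B\<^sub>r\<^sub>+\<^sub>1(a/6)\<close>, and the reflection and duplication formulas reduce these to
  \<open>B\<^sub>r\<^sub>+\<^sub>1(1/3)\<close>.
\<close>

section \<open>Congruences between rationals\<close>

text \<open>The reduced denominator divides the denominator of every other representation, so any
  fraction with denominator prime to \<open>p\<close> will do. Closure under arithmetic then needs
  no reduction to lowest terms.\<close>

lemma p_integral_iff:
  assumes p: "prime p"
  shows "p_integral p x \<longleftrightarrow> (\<exists>a b. \<not> int p dvd b \<and> x = of_int a / of_int b)"
proof
  obtain a b where ab: "quotient_of x = (a, b)" by force
  assume "p_integral p x"
  thus "\<exists>a b. \<not> int p dvd b \<and> x = of_int a / of_int b"
    using quotient_of_div[OF ab] ab by (auto simp: p_integral_def)
next
  assume "\<exists>a b. \<not> int p dvd b \<and> x = of_int a / of_int b"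
  then obtain a b where ab: "\<not> int p dvd b" "x = of_int a / of_int b" by blast
  obtain c d where cd: "quotient_of x = (c, d)" by force
  have d: "d > 0" "coprime c d" "x = of_int c / of_int d"
    using quotient_of_denom_pos[OF cd] quotient_of_coprime[OF cd] quotient_of_div[OF cd] by auto
  have "b \<noteq> 0" using ab by auto
  have "(of_int (a * d) :: rat) = of_int (c * b)"
    using ab(2) d \<open>b \<noteq> 0\<close> by (simp add: field_simps)
  hence eq: "a * d = c * b" by (simp only: of_int_eq_iff)
  have "d dvd b" using d(2) eq
    by (metis coprime_commute coprime_dvd_mult_right_iff dvd_triv_right)
  thus "p_integral p x" using ab(1) cd by (auto simp: p_integral_def intro: dvd_trans)
qed

text \<open>Integrality of the two sides is left out, so this is an equivalence relation on all
  rationals and chains of congruences carry no side conditions;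
  \<open>pcong_imp_rat_cong_pow\<close> restores it at the end.\<close>

definition pcong :: "nat \<Rightarrow> nat \<Rightarrow> rat \<Rightarrow> rat \<Rightarrow> bool" where
  "pcong p s x y \<longleftrightarrow> p_integral p ((x - y) / of_nat p ^ s)"

locale prime_modulus =
  fixes p :: nat
  assumes p: "prime p"
begin

lemma p_integral_of_int [simp, intro]: "p_integral p (of_int a)"
  using p by (subst p_integral_iff[OF p], intro exI[of _ a] exI[of _ 1])
             (auto dest: prime_gt_1_nat)

lemma p_integral_of_nat [simp, intro]: "p_integral p (of_nat a)"
  using p_integral_of_int[of "int a"] by simp

lemma p_integral_numeral [simp, intro]:
  "p_integral p 0" "p_integral p 1" "p_integral p (numeral k)"
  using p_integral_of_int[of 0] p_integral_of_int[of 1] p_integral_of_int[of "numeral k"] by auto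

lemma p_integral_mult [intro]:
  assumes "p_integral p x" "p_integral p y"
  shows "p_integral p (x * y)"
proof -
  obtain a b c d where "\<not> int p dvd b" "x = of_int a / of_int b"
    "\<not> int p dvd d" "y = of_int c / of_int d"
    using assms unfolding p_integral_iff[OF p] by blast
  moreover from this have "\<not> int p dvd b * d" using p by (simp add: prime_dvd_mult_iff)
  ultimately show ?thesis unfolding p_integral_iff[OF p]
    by (intro exI[of _ "a * c"] exI[of _ "b * d"]) auto
qed

lemma p_integral_add [intro]:
  assumes "p_integral p x" "p_integral p y"
  shows "p_integral p (x + y)"
proof -
  obtain a b c d where *: "\<not> int p dvd b" "x = of_int a / of_int b"
    "\<not> int p dvd d" "y = of_int c / of_int d"
    using assms unfolding p_integral_iff[OF p] by blast
  moreover from this have "\<not> int p dvd b * d" using p by (simp add: prime_dvd_mult_iff)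
  moreover have "b \<noteq> 0" "d \<noteq> 0" using * by auto
  ultimately show ?thesis unfolding p_integral_iff[OF p]
    by (intro exI[of _ "a * d + c * b"] exI[of _ "b * d"]) (auto simp: field_simps)
qed

lemma p_integral_uminus [intro]: "p_integral p x \<Longrightarrow> p_integral p (- x)"
  using p_integral_mult[of "-1" x] p_integral_of_int[of "-1"] by simp

lemma p_integral_diff [intro]: "p_integral p x \<Longrightarrow> p_integral p y \<Longrightarrow> p_integral p (x - y)"
  using p_integral_add[of x "-y"] by auto

lemma p_integral_power [intro]: "p_integral p x \<Longrightarrow> p_integral p (x ^ k)"
  by (induction k) auto

lemma p_integral_sum [intro]: "(\<And>i. i \<in> A \<Longrightarrow> p_integral p (f i)) \<Longrightarrow> p_integral p (sum f A)"
  by (induction A rule: infinite_finite_induct) auto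

lemma p_integral_inverse_of_nat:
  assumes "\<not> p dvd k" shows "p_integral p (1 / of_nat k)"
  unfolding p_integral_iff[OF p] using assms by (intro exI[of _ 1] exI[of _ "int k"]) simp

lemma p_integral_divide_of_nat [intro]:
  "p_integral p x \<Longrightarrow> \<not> p dvd k \<Longrightarrow> p_integral p (x / of_nat k)"
  using p_integral_mult[OF _ p_integral_inverse_of_nat] by simp

lemma pcong_refl [simp, intro]: "pcong p s x x"
  by (simp add: pcong_def)

lemma pcong_sym: "pcong p s x y \<Longrightarrow> pcong p s y x"
  unfolding pcong_def using p_integral_uminus by (fastforce simp: diff_divide_distrib)

lemma pcong_add: "pcong p s x y \<Longrightarrow> pcong p s x' y' \<Longrightarrow> pcong p s (x + x') (y + y')"
  unfolding pcong_def
  by (drule (1) p_integral_add) (simp add: add_divide_distrib diff_divide_distrib algebra_simps)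

lemma pcong_trans [trans]: "pcong p s x y \<Longrightarrow> pcong p s y z \<Longrightarrow> pcong p s x z"
  using pcong_add[of s x y y z] by (simp add: pcong_def)

lemma pcong_uminus: "pcong p s x y \<Longrightarrow> pcong p s (- x) (- y)"
  unfolding pcong_def by (drule p_integral_uminus) (simp add: diff_divide_distrib)

lemma pcong_diff: "pcong p s x y \<Longrightarrow> pcong p s x' y' \<Longrightarrow> pcong p s (x - x') (y - y')"
  using pcong_add[of s x y "-x'" "-y'"] pcong_uminus[of s x' y'] by simp

lemma pcong_mult_left: "pcong p s x y \<Longrightarrow> p_integral p z \<Longrightarrow> pcong p s (z * x) (z * y)"
  unfolding pcong_def by (drule (1) p_integral_mult) (simp add: diff_divide_distrib algebra_simps)

text \<open>Lifts the even case, known modulo \<open>p\<close>, to the modulus \<open>p ^ 2\<close>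
  of the odd case.\<close>

lemma pcong_Suc_mult:
  assumes "pcong p s x y" shows "pcong p (Suc s) (of_nat p * x) (of_nat p * y)"
  using assms p unfolding pcong_def by (simp add: prime_gt_0_nat flip: right_diff_distrib)

lemma pcong_mult:
  "pcong p s x y \<Longrightarrow> pcong p s x' y' \<Longrightarrow> p_integral p x' \<Longrightarrow> p_integral p y \<Longrightarrow>
   pcong p s (x * x') (y * y')"
  using pcong_mult_left[of s x y x'] pcong_mult_left[of s x' y' y]
  by (metis mult.commute pcong_trans)

lemma pcong_sum: "(\<And>i. i \<in> A \<Longrightarrow> pcong p s (f i) (g i)) \<Longrightarrow> pcong p s (sum f A) (sum g A)"
  by (induction A rule: infinite_finite_induct) (auto intro: pcong_add)

lemma pcong_mult_cancel_of_nat: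
  assumes "pcong p s (of_nat k * x) (of_nat k * y)" "\<not> p dvd k"
  shows "pcong p s x y"
proof -
  have "k \<noteq> 0" using assms(2) by (intro notI) simp
  thus ?thesis
    using pcong_mult_left[OF assms(1) p_integral_inverse_of_nat[OF assms(2)]] by simp
qed

lemma pcong_imp_rat_cong_pow:
  assumes "p_integral p x" "pcong p s x y" shows "rat_cong_pow p s x y"
proof -
  \<comment> \<open>The term subtracted from \<open>x\<close> is \<open>x - y\<close>, so this
    expression is \<open>y\<close>.\<close>
  have "p_integral p (x - of_nat p ^ s * ((x - y) / of_nat p ^ s))"
    using assms unfolding pcong_def
    by (intro p_integral_diff p_integral_mult p_integral_power p_integral_of_nat)
  hence "p_integral p y" using p by (simp add: prime_gt_0_nat)
  thus ?thesis using assms by (simp add: rat_cong_pow_def pcong_def)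
qed

lemma pcong_1_of_dvd: "int p dvd a - b \<Longrightarrow> pcong p 1 (of_int a) (of_int b)"
proof -
  assume "int p dvd a - b"
  then obtain k where k: "a - b = int p * k" by blast
  have "(of_int a - of_int b :: rat) = of_nat p * of_int k"
    using k by (metis of_int_diff of_int_mult of_int_of_nat_eq)
  thus ?thesis using p by (simp add: pcong_def prime_gt_0_nat)
qed

lemma pcong_0_mult: "p_integral p x \<Longrightarrow> pcong p s (of_nat p ^ s * x) 0"
  using p by (simp add: pcong_def)

section \<open>Fermat's theorem and power sums modulo \<open>p\<close>\<close>

lemma pcong_fermat:
  assumes "\<not> p dvd k" shows "pcong p 1 (of_nat k ^ (p - 1)) 1"
proof -
  have "[int (k ^ (p - 1)) = int 1] (mod int p)"
    using fermat_theorem[OF p assms] by (simp only: cong_int_iff)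
  hence "int p dvd int (k ^ (p - 1)) - 1" by (simp add: cong_iff_dvd_diff)
  from pcong_1_of_dvd[OF this] show ?thesis by simp
qed

text \<open>Multiplication by a primitive root \<open>g\<close> permutes the residues, so the sum T
  satisfies T = \<open>g ^ r\<close> T modulo \<open>p\<close>, while \<open>g ^ r\<close> is not 1
  modulo \<open>p\<close>.\<close>

lemma dvd_power_sum:
  assumes r: "\<not> (p - 1) dvd r"
  shows "int p dvd (\<Sum>s<p. int s ^ r)"
proof -
  obtain g where g: "residue_primroot p g"
    using prime_primitive_root_exists[of p] p prime_gt_1_nat[of p] by auto
  hence cop: "coprime p g" and ord: "ord p g = p - 1"
    using p by (auto simp: residue_primroot_def totient_prime)
  let ?T = "\<Sum>s<p. int s ^ r"
  have "inj_on (\<lambda>s. g * s mod p) {..<p}"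
  proof (rule inj_onI)
    fix x y assume xy: "x \<in> {..<p}" "y \<in> {..<p}" "g * x mod p = g * y mod p"
    hence "[g * x = g * y] (mod p)" by (simp add: cong_def)
    hence "[x = y] (mod p)" using cop by (simp add: cong_mult_lcancel_nat coprime_commute)
    thus "x = y" using xy by (simp add: cong_def)
  qed
  moreover have "(\<lambda>s. g * s mod p) ` {..<p} \<subseteq> {..<p}" using p prime_gt_0_nat by auto
  ultimately have bij: "bij_betw (\<lambda>s. g * s mod p) {..<p} {..<p}"
    by (simp add: bij_betw_def endo_inj_surj)
  have "?T = (\<Sum>s<p. int (g * s mod p) ^ r)"
    using sum.reindex_bij_betw[OF bij, of "\<lambda>s. int s ^ r"] by simp
  also have "[\<dots> = (\<Sum>s<p. (int g * int s) ^ r)] (mod int p)"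
    by (intro cong_sum cong_pow) (simp add: cong_def zmod_int)
  also have "(\<Sum>s<p. (int g * int s) ^ r) = int g ^ r * ?T"
    by (simp add: power_mult_distrib sum_distrib_left)
  finally have "int p dvd int g ^ r * ?T - ?T"
    by (simp add: cong_iff_dvd_diff dvd_diff_commute)
  hence "int p dvd (int g ^ r - 1) * ?T" by (simp add: algebra_simps)
  moreover have "\<not> int p dvd int g ^ r - 1"
  proof
    assume "int p dvd int g ^ r - 1"
    hence "[int (g ^ r) = int 1] (mod int p)" by (simp add: cong_iff_dvd_diff)
    hence "[g ^ r = 1] (mod p)" by (simp only: cong_int_iff)
    thus False using r ord ord_divides[of g r p] by metis
  qed
  ultimately show ?thesis using p by (simp add: prime_dvd_mult_iff)
qed

lemma pcong_power_sum:
  assumes "r = 0 \<or> \<not> (p - 1) dvd r"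
  shows "pcong p 1 (\<Sum>s<p. of_nat s ^ r) 0"
proof (cases "r = 0")
  case True
  \<comment> \<open>Since \<open>0 ^ 0 = 1\<close>, the sum for exponent 0 is exactly
    \<open>p\<close>. For exponent \<open>p - 1\<close> the term at 0 vanishes instead, which leaves
    \<open>p - 1\<close> ones modulo \<open>p\<close>.\<close>
  thus ?thesis using p by (simp add: pcong_def)
next
  case False
  thus ?thesis using pcong_1_of_dvd[of "\<Sum>s<p. int s ^ r" 0] dvd_power_sum[of r] assms by simp
qed

lemma pcong_power_sum_fermat: "pcong p 1 (\<Sum>s<p. of_nat s ^ (p - 1)) (- 1)"
proof -
  have p1: "p > 1" using p prime_gt_1_nat by blast
  have "(\<Sum>s<p. of_nat s ^ (p - 1)) = (\<Sum>s=1..<p. of_nat s ^ (p - 1) :: rat)"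
    using p1 by (intro sum.mono_neutral_right) (auto simp: not_less_eq_eq)
  also have "pcong p 1 \<dots> (\<Sum>s=1..<p. 1)"
    by (intro pcong_sum pcong_fermat) (auto dest: dvd_imp_le)
  also have "(\<Sum>s=1..<p. 1) = (of_nat p - 1 :: rat)" using p1 by (simp add: of_nat_diff)
  also have "pcong p 1 \<dots> (- 1)" using p1 by (simp add: pcong_def)
  finally show ?thesis .
qed

end

section \<open>The generating polynomial\<close>

lemma Legendre_3_cong: "x mod 3 = y mod 3 \<Longrightarrow> Legendre x 3 = Legendre y 3"
  by (simp add: Legendre_3)

lemma Legendre_3_uminus: "Legendre (- x) 3 = - Legendre x 3"
proof -
  have "x mod 3 = 0 \<and> (- x) mod 3 = 0 \<or> x mod 3 = 1 \<and> (- x) mod 3 = 2 \<or>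
        x mod 3 = 2 \<and> (- x) mod 3 = 1" by presburger
  thus ?thesis by (auto simp: Legendre_3)
qed

text \<open>The three arguments cover all residues modulo 3. The shift 1 serves the binomial sum,
  the shift \<open>p\<close> the periodic weights of the even case.\<close>

lemma Legendre_3_sum:
  assumes "\<not> 3 dvd y" shows "Legendre x 3 + Legendre (x + y) 3 + Legendre (x + 2 * y) 3 = 0"
proof -
  have "y mod 3 = 1 \<or> y mod 3 = 2" using assms by presburger
  moreover have "x mod 3 = 0 \<or> x mod 3 = 1 \<or> x mod 3 = 2" by presburger
  moreover have "(x + y) mod 3 = (x mod 3 + y mod 3) mod 3"
    "(x + 2 * y) mod 3 = (x mod 3 + 2 * (y mod 3)) mod 3" by presburger+
  ultimately show ?thesis by (elim disjE) (simp_all add: Legendre_3)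
qed

section \<open>Increasing tuples and multiple harmonic sums\<close>

lemma incr_tuples_0 [simp]: "incr_tuples 0 k = {[]}"
  by (auto simp: incr_tuples_def)

lemma incr_tuples_bound_0 [simp]: "incr_tuples (Suc n) 0 = {}" "incr_tuples (Suc n) (Suc 0) = {}"
  by (auto simp: incr_tuples_def length_Suc_conv)

lemma incr_tuples_Suc:
  assumes "k > 0"
  shows "incr_tuples (Suc n) (Suc k) = incr_tuples (Suc n) k \<union> (\<lambda>ks. ks @ [k]) ` incr_tuples n k"
proof (intro equalityI subsetI)
  fix ks assume ks: "ks \<in> incr_tuples (Suc n) (Suc k)"
  then obtain ys l where ys: "ks = ys @ [l]"
    by (cases ks rule: rev_exhaust) (auto simp: incr_tuples_def)
  show "ks \<in> incr_tuples (Suc n) k \<union> (\<lambda>ks. ks @ [k]) ` incr_tuples n k"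
  proof (cases "l = k")
    case True
    thus ?thesis using ks ys
      by (intro UnI2 image_eqI[of _ _ ys]) (fastforce simp: incr_tuples_def sorted_wrt_append)+
  next
    case False
    thus ?thesis using ks ys
      by (intro UnI1) (fastforce simp: incr_tuples_def sorted_wrt_append)
  qed
qed (use assms in \<open>fastforce simp: incr_tuples_def sorted_wrt_append\<close>)

definition harm_sum :: "nat \<Rightarrow> nat \<Rightarrow> rat" where
  "harm_sum n p = (\<Sum>ks\<in>incr_tuples n p. 1 / (\<Prod>k\<leftarrow>ks. of_nat k))"

text \<open>Groups the tuples by their last entry \<open>k\<close>; what precedes it is an arbitrary
  increasing tuple below \<open>k\<close>. Constant weight yields the recurrence of
  \<open>harm_sum\<close>, the Legendre weight yields \<open>legendre_sum\<close>.\<close>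

lemma sum_incr_tuples_Suc:
  fixes w :: "nat \<Rightarrow> rat"
  shows "(\<Sum>ks\<in>incr_tuples (Suc n) p. w (last ks) / (\<Prod>k\<leftarrow>ks. of_nat k)) =
         (\<Sum>k\<in>{0<..<p}. w k / of_nat k * harm_sum n k)"
proof (induction p)
  case 0
  show ?case by simp
next
  case (Suc p)
  show ?case
  proof (cases "p = 0")
    case True
    have "{0<..<Suc 0} = {}" by auto
    with True show ?thesis by simp
  next
    case False
    have disj: "incr_tuples (Suc n) p \<inter> (\<lambda>ks. ks @ [p]) ` incr_tuples n p = {}"
      by (auto simp: incr_tuples_def)
    have inj: "inj_on (\<lambda>ks. ks @ [p]) (incr_tuples n p)"
      by (auto simp: inj_on_def)
    have "{0<..<Suc p} = insert p {0<..<p}" using False by auto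
    moreover have "(\<Sum>ks\<in>incr_tuples n p. w p / ((\<Prod>k\<leftarrow>ks. of_nat k) * of_nat p)) =
                   w p / of_nat p * harm_sum n p"
      by (simp add: harm_sum_def sum_distrib_left mult_ac)
    ultimately show ?thesis
      using False disj Suc.IH
      by (simp add: incr_tuples_Suc sum.union_disjoint finite_incr_tuples sum.reindex[OF inj])
  qed
qed

lemma harm_sum_0 [simp]: "harm_sum 0 p = 1"
  by (simp add: harm_sum_def)

lemma harm_sum_Suc:
  "k > 0 \<Longrightarrow> harm_sum (Suc n) (Suc k) = harm_sum (Suc n) k + harm_sum n k / of_nat k"
proof -
  assume "k > 0"
  hence "{0<..<Suc k} = insert k {0<..<k}" by auto
  thus ?thesis using sum_incr_tuples_Suc[of "\<lambda>_. 1"]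
    by (simp add: harm_sum_def[of "Suc n"])
qed

text \<open>\<open>harm_sum n k\<close> is the elementary symmetric function of degree
  \<open>n\<close> in the reciprocals of 1, ..., k - 1.\<close>

lemma coeff_prod_harm:
  "coeff (\<Prod>j\<in>{0<..<k}. [:1, - (1 / of_nat j):]) n = (-1) ^ n * harm_sum n k"
proof (induction k arbitrary: n)
  case 0
  show ?case by (cases n) (simp_all add: harm_sum_def)
next
  case (Suc k)
  show ?case
  proof (cases "k = 0")
    case True
    have "{0<..<Suc 0} = {}" by auto
    with True show ?thesis by (cases n) (simp_all add: harm_sum_def)
  next
    case False
    hence "{0<..<Suc k} = insert k {0<..<k}" by auto
    hence "(\<Prod>j\<in>{0<..<Suc k}. [:1, - (1 / of_nat j):]) =
           [:1, - (1 / of_nat k):] * (\<Prod>j\<in>{0<..<k}. [:1, - (1 / rat_of_nat j):])" by simp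
    thus ?thesis using False Suc.IH
      by (cases n) (simp_all add: mult_pCons_left coeff_pCons harm_sum_Suc algebra_simps)
  qed
qed

text \<open>For \<open>k > 0\<close> this is \<open>(-1) ^ k\<close> times binom(s, k) as a
  polynomial in s, factored as -(s/k) times the product of the 1 - s/j, so that the coefficients are
  harmonic sums. At \<open>k = 0\<close> division by zero makes it 0.\<close>

definition gbinom_poly :: "nat \<Rightarrow> rat poly" where
  "gbinom_poly k = [:0, - (1 / of_nat k):] * (\<Prod>j\<in>{0<..<k}. [:1, - (1 / of_nat j):])"

lemma poly_gbinom_poly:
  assumes "k > 0" shows "poly (gbinom_poly k) s = (-1) ^ k * (s gchoose k)"
  using assms
proof (induction k rule: nat_induct_non_zero)
  case 1
  have "{0<..<Suc 0} = {}" by auto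
  thus ?case by (simp add: gbinom_poly_def)
next
  case (Suc k)
  hence "{0<..<Suc k} = insert k {0<..<k}" by auto
  hence "poly (gbinom_poly (Suc k)) s =
    - (s / of_nat (Suc k)) * ((1 - s / of_nat k) * poly (\<Prod>j\<in>{0<..<k}. [:1, - (1 / of_nat j):]) s)"
    by (simp add: gbinom_poly_def algebra_simps del: of_nat_Suc)
  hence "of_nat (Suc k) * poly (gbinom_poly (Suc k)) s =
    - s * ((1 - s / of_nat k) * poly (\<Prod>j\<in>{0<..<k}. [:1, - (1 / of_nat j):]) s)"
    by (simp del: of_nat_Suc)
  also have "\<dots> = (of_nat k - s) * poly (gbinom_poly k) s"
    using Suc.hyps by (simp add: gbinom_poly_def field_simps)
  also have "\<dots> = (-1) ^ k * (of_nat k * (s gchoose k) - s * (s gchoose k))"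
    unfolding Suc.IH by (simp add: algebra_simps)
  also have "\<dots> = of_nat (Suc k) * ((-1) ^ Suc k * (s gchoose Suc k))"
    unfolding gbinomial_mult_1 by simp
  finally show ?case by (simp only: mult_left_cancel[OF of_nat_neq_0])
qed

lemma degree_gbinom_poly:
  assumes "k > 0" shows "degree (gbinom_poly k) \<le> k"
proof -
  have "degree (\<Prod>j\<in>{0<..<k}. [:1, - (1 / rat_of_nat j):]) \<le>
      sum (degree \<circ> (\<lambda>j. [:1, - (1 / rat_of_nat j):])) {0<..<k}"
    by (rule degree_prod_sum_le) simp
  also have "\<dots> \<le> (\<Sum>j\<in>{0<..<k}. 1)" by (intro sum_mono) auto
  finally show ?thesis unfolding gbinom_poly_def
    using assms by (intro order.trans[OF degree_mult_le]) auto
qed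

lemma coeff_gbinom_poly:
  "coeff (gbinom_poly k) (Suc n) = (-1) ^ Suc n * (harm_sum n k / of_nat k)"
  by (simp add: gbinom_poly_def coeff_prod_harm)

text \<open>The polynomial G. Its term for \<open>k = 0\<close> is written separately because
  \<open>gbinom_poly 0\<close> is 0; the factor \<open>(-1) ^ k\<close> cancels the sign in
  \<open>gbinom_poly\<close>.\<close>

definition legendre_poly :: "nat \<Rightarrow> rat poly" where
  "legendre_poly p = [:of_int (Legendre (int p) 3):] +
     (\<Sum>k\<in>{0<..<p}. smult (of_int (Legendre (int p - int k) 3) * (-1) ^ k) (gbinom_poly k))"

lemma coeff_legendre_poly:
  assumes "n > 0" shows "coeff (legendre_poly p) n = (-1) ^ n * legendre_sum n p"
proof -
  obtain m where n: "n = Suc m" using assms gr0_implies_Suc by blast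
  show ?thesis
    using sum_incr_tuples_Suc[of "\<lambda>k. of_int (Legendre (int p - int k) 3) * (-1) ^ k" m p]
    by (simp add: n legendre_poly_def legendre_sum_def coeff_sum coeff_gbinom_poly
          sum_distrib_left mult_ac flip: sum_negf)
qed

lemma degree_legendre_poly: "p > 0 \<Longrightarrow> degree (legendre_poly p) < p"
  unfolding legendre_poly_def
  by (intro degree_add_less degree_sum_less)
     (auto intro!: le_less_trans[OF degree_smult_le] le_less_trans[OF degree_gbinom_poly])

lemma poly_legendre_poly:
  assumes "p > 0"
  shows "poly (legendre_poly p) s = (\<Sum>k<p. of_int (Legendre (int p - int k) 3) * (s gchoose k))"
proof -
  have "{..<p} = insert 0 {0<..<p}" using assms by auto
  thus ?thesis by (simp add: legendre_poly_def poly_sum poly_gbinom_poly mult.assoc flip: power_add)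
qed

text \<open>By Pascal's rule each step adds the sums at \<open>x\<close> and \<open>x - 1\<close>,
  and \<chi>(y) + \<chi>(y - 1) = -\<chi>(y + 1).\<close>

lemma sum_binomial_Legendre:
  "(\<Sum>k\<le>s. of_nat (s choose k) * Legendre (x - int k) 3) = (-1) ^ s * Legendre (x + int s) 3"
proof (induction s arbitrary: x)
  case 0
  show ?case by simp
next
  case (Suc s)
  have "(\<Sum>k\<le>Suc s. of_nat (Suc s choose k) * Legendre (x - int k) 3) =
        (\<Sum>k\<le>s. of_nat (s choose k) * Legendre (x - int k) 3) +
        (\<Sum>k\<le>s. of_nat (s choose k) * Legendre (x - 1 - int k) 3)"
  proof -
    have "(\<Sum>k\<le>s. of_nat (s choose k) * Legendre (x - int k) 3) =
          (\<Sum>k\<le>Suc s. of_nat (s choose k) * Legendre (x - int k) 3)" by simp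
    thus ?thesis unfolding sum.atMost_Suc_shift
      by (simp add: sum.distrib algebra_simps del: sum.atMost_Suc)
  qed
  also have "\<dots> = (-1) ^ s * (Legendre (x + int s) 3 + Legendre (x + int s - 1) 3)"
    unfolding Suc.IH by (simp add: algebra_simps)
  also have "Legendre (x + int s) 3 + Legendre (x + int s - 1) 3 = - Legendre (x + int (Suc s)) 3"
    using Legendre_3_sum[of 1 "x + int s - 1"] by (simp add: algebra_simps)
  finally show ?case by simp
qed

lemma poly_legendre_poly_of_nat:
  assumes "p > 0" "s \<le> p"
  shows "poly (legendre_poly p) (of_nat s) = of_int ((-1) ^ s * Legendre (int p + int s) 3)"
proof -
  have "poly (legendre_poly p) (of_nat s) =
        (\<Sum>k<p. of_nat (s choose k) * of_int (Legendre (int p - int k) 3))"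
    using assms by (simp add: poly_legendre_poly binomial_gbinomial mult.commute)
  \<comment> \<open>The new term \<open>k = p\<close> carries \<chi>(0) = 0. Completing the range
    makes the evaluation valid at \<open>s = p\<close> too.\<close>
  also have "\<dots> = (\<Sum>k\<le>p. of_nat (s choose k) * of_int (Legendre (int p - int k) 3))"
    unfolding lessThan_Suc_atMost[symmetric] by (simp add: Legendre_3)
  also have "\<dots> = (\<Sum>k\<le>s. of_nat (s choose k) * of_int (Legendre (int p - int k) 3))"
    using assms by (intro sum.mono_neutral_right) auto
  also have "\<dots> = of_int (\<Sum>k\<le>s. of_nat (s choose k) * Legendre (int p - int k) 3)" by simp
  finally show ?thesis by (simp only: sum_binomial_Legendre)
qed

text \<open>Both sides have degree below \<open>p\<close> and agree at the p + 1 points 0, ..., p.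
  There \<chi>(2p - s) = -\<chi>(p + s), and oddness of \<open>p\<close> supplies a second
  sign.\<close>

lemma legendre_poly_reflect:
  assumes "odd p"
  shows "pcompose (legendre_poly p) [:of_nat p, -1:] = legendre_poly p"
proof (rule poly_eqI_degree[of "of_nat ` {..p}"])
  have p0: "p > 0" using assms by (cases p) auto
  fix x :: rat assume "x \<in> of_nat ` {..p}"
  then obtain s where s: "x = of_nat s" "s \<le> p" by auto
  have "poly (legendre_poly p) (of_nat (p - s)) = of_int ((-1) ^ (p - s) * Legendre (2 * int p - int s) 3)"
    using poly_legendre_poly_of_nat[of p "p - s"] p0 s by (simp add: of_nat_diff)
  also have "Legendre (2 * int p - int s) 3 = - Legendre (int p + int s) 3"
    by (subst Legendre_3_uminus [symmetric], rule Legendre_3_cong) presburger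
  also have "(-1) ^ (p - s) = - ((-1) ^ s :: int)"
    using assms s by (simp add: uminus_power_if)
  finally show "poly (pcompose (legendre_poly p) [:of_nat p, -1:]) x = poly (legendre_poly p) x"
    using poly_legendre_poly_of_nat[of p s] p0 s by (simp add: poly_pcompose of_nat_diff)
next
  have p0: "p > 0" using assms by (cases p) auto
  have c: "card (rat_of_nat ` {..p}) = Suc p" by (subst card_image) (auto simp: inj_on_def)
  show "degree (legendre_poly p) < card (rat_of_nat ` {..p})"
    using degree_legendre_poly[OF p0] c by simp
  thus "degree (pcompose (legendre_poly p) [:of_nat p, -1:]) < card (rat_of_nat ` {..p})"
    by (simp add: degree_pcompose)
qed

section \<open>Coefficients after a linear substitution\<close>

lemma pcompose_power: "pcompose (q ^ m) r = pcompose q r ^ m"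
  by (induction m) (simp_all add: pcompose_mult pcompose_1)

lemma coeff_pcompose_linear:
  fixes q :: "'a :: comm_ring_1 poly"
  assumes "degree q \<le> N"
  shows "coeff (pcompose q [:a, b:]) n =
         (\<Sum>m\<le>N. coeff q m * (of_nat (m choose n) * b ^ n * a ^ (m - n)))"
proof -
  have "pcompose q [:a, b:] = (\<Sum>m\<le>N. pcompose (monom (coeff q m) m) [:a, b:])"
    using poly_as_sum_of_monoms'[OF assms] by (simp flip: pcompose_sum)
  also have "\<dots> = (\<Sum>m\<le>N. smult (coeff q m) ([:a, b:] ^ m))"
    by (intro sum.cong refl)
       (simp add: monom_altdef pcompose_smult pcompose_power pcompose_pCons)
  finally have eq: "pcompose q [:a, b:] = (\<Sum>m\<le>N. smult (coeff q m) ([:a, b:] ^ m))" .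
  have "coeff ([:a, b:] ^ m) n = of_nat (m choose n) * b ^ n * a ^ (m - n)" for m
  proof (cases "n \<le> m")
    case False
    have "degree ([:a, b:] ^ m) \<le> degree [:a, b:] * m" by (rule degree_power_le)
    also have "\<dots> \<le> 1 * m" by (intro mult_right_mono) auto
    finally show ?thesis using False by (simp add: coeff_eq_0 binomial_eq_0)
  qed (simp add: coeff_linear_poly_power)
  thus ?thesis unfolding eq by (simp add: coeff_sum)
qed

section \<open>Bernoulli polynomials\<close>

lemma fps_exp_minus_1_neq_0: "fps_exp 1 - 1 \<noteq> (0 :: 'a :: field_char_0 fps)"
proof
  assume "fps_exp 1 - 1 = (0 :: 'a fps)"
  hence "fps_nth (fps_exp 1 - 1 :: 'a fps) 1 = 0" by simp
  thus False by simp
qed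

text \<open>Identities between generating functions are checked after multiplication by
  \<open>fps_exp 1 - 1\<close>, avoiding division of power series.\<close>

lemma bernoulli_gf_unique:
  fixes x :: "'a :: field_char_0"
  assumes "f * (fps_exp 1 - 1) = fps_X * fps_exp x" shows "f = bernoulli_gf x"
  using bernoulli_gf_times[of x] assms fps_exp_minus_1_neq_0 by (metis mult_right_cancel)

lemma bernoulli_poly_plus_1:
  fixes x :: "'a :: field_char_0"
  shows "bernoulli_poly (Suc m) (x + 1) - bernoulli_poly (Suc m) x = of_nat (Suc m) * x ^ m"
proof -
  have "bernoulli_gf (x + 1) = bernoulli_gf x + fps_X * fps_exp x"
    using bernoulli_gf_times[of x]
    by (intro bernoulli_gf_unique [symmetric]) (simp add: algebra_simps fps_exp_add_mult)
  thus ?thesis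
    by (simp add: bernoulli_poly_def ring_distribs field_simps del: of_nat_Suc)
qed

text \<open>Substitute -t for t in the generating function, then multiply by e^t to turn e^(-t) - 1
  into -(e^t - 1).\<close>

lemma bernoulli_poly_reflect:
  fixes x :: "'a :: field_char_0"
  shows "bernoulli_poly m (1 - x) = (-1) ^ m * bernoulli_poly m x"
proof -
  let ?c = "\<lambda>f :: 'a fps. fps_compose f (fps_const (-1) * fps_X)"
  have "?c (bernoulli_gf x) * (fps_exp (-1) - 1) = ?c (bernoulli_gf x * (fps_exp 1 - 1))"
    by (subst fps_compose_mult_distrib) (simp_all add: fps_compose_sub_distrib)
  also have "\<dots> = - fps_X * fps_exp (- x)"
    unfolding bernoulli_gf_times
    by (subst fps_compose_mult_distrib) (simp_all flip: fps_const_neg)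
  finally have "?c (bernoulli_gf x) * (fps_exp (-1) - 1) * fps_exp 1 = - fps_X * fps_exp (- x) * fps_exp 1"
    by simp
  moreover have "(fps_exp (-1) - 1) * fps_exp 1 = - (fps_exp 1 - 1 :: 'a fps)"
    by (simp add: ring_distribs flip: fps_exp_add_mult)
  moreover have "fps_exp (- x) * fps_exp 1 = fps_exp (1 - x)"
    by (simp flip: fps_exp_add_mult)
  ultimately have "?c (bernoulli_gf x) * - (fps_exp 1 - 1) = - (fps_X * fps_exp (1 - x))"
    by (simp only: mult.assoc) simp
  hence "?c (bernoulli_gf x) * (fps_exp 1 - 1) = fps_X * fps_exp (1 - x)"
    by (simp only: mult_minus_right neg_equal_iff_equal)
  from bernoulli_gf_unique[OF this] have "bernoulli_gf (1 - x) = ?c (bernoulli_gf x)" ..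
  thus ?thesis by (simp only: bernoulli_poly_def fps_nth_compose_linear) (simp add: mult_ac)
qed

text \<open>Substitute 2t for t and cancel e^t + 1 through e^(2t) - 1 = (e^t - 1)(e^t + 1).\<close>

lemma bernoulli_poly_double:
  fixes x :: "'a :: field_char_0"
  shows "2 ^ m * (bernoulli_poly m x + bernoulli_poly m (x + 1 / 2)) = 2 * bernoulli_poly m (2 * x)"
proof -
  let ?c = "\<lambda>f :: 'a fps. fps_compose f (fps_const 2 * fps_X)"
  have "?c (bernoulli_gf x + bernoulli_gf (x + 1 / 2)) * (fps_exp 2 - 1) =
        ?c ((bernoulli_gf x + bernoulli_gf (x + 1 / 2)) * (fps_exp 1 - 1))"
    by (subst fps_compose_mult_distrib) (simp_all add: fps_compose_sub_distrib)
  also have "\<dots> = ?c (fps_X * (fps_exp x + fps_exp (x + 1 / 2)))"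
    by (simp only: distrib_left distrib_right bernoulli_gf_times)
  also have "\<dots> = fps_const 2 * fps_X * (fps_exp (2 * x) + fps_exp (2 * x + 1))"
    by (simp add: fps_compose_mult_distrib fps_compose_add_distrib distrib_left)
  also have "\<dots> = fps_const 2 * fps_X * fps_exp (2 * x) * (fps_exp 1 + 1)"
    by (simp add: fps_exp_add_mult algebra_simps)
  also have "\<dots> = fps_const 2 * bernoulli_gf (2 * x) * (fps_exp 1 - 1) * (fps_exp 1 + 1)"
    by (simp add: bernoulli_gf_times mult.assoc)
  also have "\<dots> = fps_const 2 * bernoulli_gf (2 * x) * (fps_exp 2 - 1)"
    using fps_exp_add_mult[of 1 "1 :: 'a"] by (simp add: algebra_simps)
  finally have eq: "?c (bernoulli_gf x + bernoulli_gf (x + 1 / 2)) * (fps_exp 2 - 1) =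
                fps_const 2 * bernoulli_gf (2 * x) * (fps_exp 2 - 1)" .
  have "fps_nth (fps_exp 2 - 1 :: 'a fps) 1 \<noteq> 0" by simp
  hence "fps_exp 2 - 1 \<noteq> (0 :: 'a fps)" by (metis fps_zero_nth)
  with eq have "?c (bernoulli_gf x + bernoulli_gf (x + 1 / 2)) = fps_const 2 * bernoulli_gf (2 * x)"
    by (metis mult_right_cancel)
  from arg_cong[OF this, of "\<lambda>f. fact m * fps_nth f m"] show ?thesis
    by (simp only: bernoulli_poly_def fps_nth_compose_linear fps_add_nth fps_mult_left_const_nth)
       (simp add: algebra_simps)
qed

text \<open>Compares coefficients of t^(m+1) in \<open>bernoulli_gf_times\<close> and solves for the
  last one. Only factorials up to \<open>fact (Suc m)\<close> occur as denominators, which gives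
  control modulo primes above \<open>Suc m\<close>.\<close>

lemma bernoulli_gf_recurrence:
  fixes x :: "'a :: field_char_0"
  shows "fps_nth (bernoulli_gf x) m =
         x ^ m / fact m - (\<Sum>j<m. fps_nth (bernoulli_gf x) j / fact (Suc m - j))"
proof -
  have "x ^ m / fact m = fps_nth (fps_X * fps_exp x) (Suc m)" by simp
  also have "\<dots> = (\<Sum>j\<le>Suc m. fps_nth (bernoulli_gf x) j * fps_nth (fps_exp 1 - 1) (Suc m - j))"
    by (simp only: bernoulli_gf_times[symmetric] fps_mult_nth atLeast0AtMost)
  also have "\<dots> = (\<Sum>j\<le>m. fps_nth (bernoulli_gf x) j * fps_nth (fps_exp 1 - 1) (Suc m - j))"
    by simp
  also have "\<dots> = (\<Sum>j\<le>m. fps_nth (bernoulli_gf x) j / fact (Suc m - j))"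
    by (intro sum.cong refl) (auto simp: Suc_diff_le simp del: fact_Suc of_nat_Suc)
  also have "\<dots> = (\<Sum>j<m. fps_nth (bernoulli_gf x) j / fact (Suc m - j)) + fps_nth (bernoulli_gf x) m"
    by (simp flip: lessThan_Suc_atMost)
  finally show ?thesis by (simp add: algebra_simps)
qed

text \<open>Consider the sum over a window of \<open>q\<close> consecutive indices starting at
  \<open>N\<close>. Moving the window by one replaces index N by N + q; since \<open>h\<close> has
  period \<open>q\<close>, the change is \<open>h N\<close> times a difference of Bernoulli values
  at arguments 1 apart, that is, a power of N/q.\<close>

lemma sum_periodic_power:
  fixes h :: "nat \<Rightarrow> 'a :: field_char_0"
  assumes per: "\<And>k. h (k + q) = h k" and "q > 0"
  shows "of_nat (Suc m) * (\<Sum>k<N. h k * of_nat k ^ m) =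
         of_nat q ^ m * (\<Sum>a<q. h (a + N) * bernoulli_poly (Suc m) (of_nat (a + N) / of_nat q)) -
         of_nat q ^ m * (\<Sum>a<q. h a * bernoulli_poly (Suc m) (of_nat a / of_nat q))"
proof (induction N)
  case 0
  show ?case by simp
next
  case (Suc N)
  let ?B = "\<lambda>k. h k * bernoulli_poly (Suc m) (of_nat k / of_nat q)"
  have "(\<Sum>a<q. ?B (a + Suc N)) - (\<Sum>a<q. ?B (a + N)) = (\<Sum>a<q. ?B (Suc a + N) - ?B (a + N))"
    by (simp add: sum_subtractf)
  also have "\<dots> = ?B (q + N) - ?B N"
    using sum_lessThan_telescope[of "\<lambda>a. ?B (a + N)" q] by simp
  also have "\<dots> = h N * (bernoulli_poly (Suc m) (of_nat N / of_nat q + 1) -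
                        bernoulli_poly (Suc m) (of_nat N / of_nat q))"
    using per[of N] assms(2) by (simp add: add.commute add_divide_distrib algebra_simps)
  also have "\<dots> = h N * (of_nat (Suc m) * (of_nat N / of_nat q) ^ m)"
    by (simp only: bernoulli_poly_plus_1)
  finally have step: "of_nat q ^ m * ((\<Sum>a<q. ?B (a + Suc N)) - (\<Sum>a<q. ?B (a + N))) =
      of_nat (Suc m) * (h N * of_nat N ^ m)"
    using assms(2) by (simp add: power_divide mult_ac)
  have "x - y + (z - x) = z - y" for x y z :: 'a by simp
  thus ?case
    unfolding sum.lessThan_Suc distrib_left Suc.IH step [symmetric] right_diff_distrib .
qed

section \<open>Bernoulli values modulo powers of \<open>p\<close>\<close>

context prime_modulus
begin

lemma p_integral_divide_fact:
  "p_integral p x \<Longrightarrow> k < p \<Longrightarrow> p_integral p (x / fact k)"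
  using p_integral_divide_of_nat[of x "fact k"] prime_dvd_fact_iff[OF p, of k] by simp

lemma pcong_divide_fact:
  "pcong p s x y \<Longrightarrow> k < p \<Longrightarrow> pcong p s (x / fact k) (y / fact k)"
  using pcong_mult_left[of s x y "1 / fact k"] p_integral_divide_fact[of 1 k]
  by (simp add: p_integral_numeral)

lemma pcong_power:
  assumes "pcong p s x y" "p_integral p x" "p_integral p y"
  shows "pcong p s (x ^ k) (y ^ k)"
  using assms
  by (induction k) (auto intro!: pcong_mult p_integral_power pcong_refl)

lemma p_integral_bernoulli_gf:
  assumes "p_integral p x" "Suc m < p"
  shows "p_integral p (fps_nth (bernoulli_gf x) m)"
  using assms(2)
proof (induction m rule: less_induct)
  case (less m)
  show ?case unfolding bernoulli_gf_recurrence[of x m]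
    using less assms(1)
    by (intro p_integral_diff p_integral_sum p_integral_divide_fact p_integral_power) auto
qed

lemma p_integral_bernoulli_poly:
  assumes "p_integral p x" "Suc m < p"
  shows "p_integral p (bernoulli_poly m x)"
  unfolding bernoulli_poly_def
  using p_integral_mult[OF p_integral_of_nat[of "fact m"] p_integral_bernoulli_gf[OF assms]]
  by simp

text \<open>The recurrence preserves congruence of the arguments, since every factorial in it is
  prime to \<open>p\<close>.\<close>

lemma pcong_bernoulli_gf:
  assumes "pcong p s x y" "p_integral p x" "p_integral p y" "Suc m < p"
  shows "pcong p s (fps_nth (bernoulli_gf x) m) (fps_nth (bernoulli_gf y) m)"
  using assms(4)
proof (induction m rule: less_induct)
  case (less m)
  show ?case unfolding bernoulli_gf_recurrence[of x m] bernoulli_gf_recurrence[of y m]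
    using less assms(1-3)
    by (intro pcong_diff pcong_sum pcong_divide_fact pcong_power) auto
qed

lemma pcong_bernoulli_poly:
  assumes "pcong p s x y" "p_integral p x" "p_integral p y" "Suc m < p"
  shows "pcong p s (bernoulli_poly m x) (bernoulli_poly m y)"
  unfolding bernoulli_poly_def
  using pcong_mult_left[OF pcong_bernoulli_gf[OF assms] p_integral_of_nat[of "fact m"]]
  by simp

end

section \<open>Coefficients of the generating polynomial\<close>

context prime_modulus
begin

lemma p_integral_legendre_sum: "p_integral p (legendre_sum n p)"
  unfolding legendre_sum_def
proof (intro p_integral_sum p_integral_mult p_integral_of_int)
  fix ks assume "ks \<in> incr_tuples n p"
  hence ks: "\<forall>k\<in>set ks. 0 < k \<and> k < p" by (auto simp: incr_tuples_def)
  have "\<not> p dvd prod_list ks"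
    using ks p by (induction ks) (auto simp: prime_dvd_mult_iff dest: dvd_imp_le)
  moreover have "(\<Prod>k\<leftarrow>ks. of_nat k) = (of_nat (prod_list ks) :: rat)"
    by (induction ks) simp_all
  ultimately show "p_integral p ((-1) ^ last ks / (\<Prod>k\<leftarrow>ks. of_nat k))"
    using p_integral_of_int[of "(-1) ^ last ks"]
    by (simp add: p_integral_divide_of_nat)
qed

lemma p_integral_coeff_legendre_poly: "p_integral p (coeff (legendre_poly p) m)"
proof (cases "m = 0")
  case True
  \<comment> \<open>The constant coefficient is no \<open>legendre_sum\<close>; it is read off as
    the value at 0.\<close>
  have "coeff (legendre_poly p) 0 = of_int (Legendre (int p) 3)"
    using poly_legendre_poly_of_nat[of p 0] p by (simp add: poly_0_coeff_0 prime_gt_0_nat)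
  thus ?thesis using True p_integral_of_int by simp
next
  case False
  thus ?thesis
    using p_integral_mult[OF p_integral_of_int[of "(-1) ^ m"] p_integral_legendre_sum]
    by (simp add: coeff_legendre_poly)
qed

text \<open>Orthogonality of powers: after expanding \<open>q\<close>, the exponent p - 1 arises
  only for \<open>m = n\<close>, and every other power sum vanishes modulo \<open>p\<close>.\<close>

lemma pcong_coeff_via_power_sums:
  assumes "degree q < p" "\<And>m. p_integral p (coeff q m)" "0 < n" "n < p"
  shows "pcong p 1 (\<Sum>s<p. poly q (of_nat s) * of_nat s ^ (p - 1 - n)) (- coeff q n)"
proof -
  have "poly q x = (\<Sum>m<p. coeff q m * x ^ m)" for x
    unfolding poly_altdef using assms(1)
    by (intro sum.mono_neutral_left) (auto simp: coeff_eq_0)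
  hence "(\<Sum>s<p. poly q (of_nat s) * of_nat s ^ (p - 1 - n)) =
        (\<Sum>s<p. \<Sum>m<p. coeff q m * of_nat s ^ (m + (p - 1 - n)))"
    by (simp add: sum_distrib_right power_add mult.assoc)
  also have "\<dots> = (\<Sum>m<p. coeff q m * (\<Sum>s<p. of_nat s ^ (m + (p - 1 - n))))"
    by (subst sum.swap) (simp add: sum_distrib_left)
  also have "pcong p 1 \<dots> (\<Sum>m<p. coeff q m * (if m = n then - 1 else 0))"
  proof (intro pcong_sum pcong_mult_left assms(2))
    fix m assume m: "m \<in> {..<p}"
    show "pcong p 1 (\<Sum>s<p. of_nat s ^ (m + (p - 1 - n))) (if m = n then - 1 else 0)"
    proof (cases "m = n")
      case True
      hence "m + (p - 1 - n) = p - 1" using assms(4) by simp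
      thus ?thesis using pcong_power_sum_fermat True by simp
    next
      case False
      have "\<not> (p - 1) dvd (m + (p - 1 - n))" if nz: "m + (p - 1 - n) \<noteq> 0"
      proof
        assume "(p - 1) dvd (m + (p - 1 - n))"
        then obtain j where j: "m + (p - 1 - n) = (p - 1) * j" by (rule dvdE)
        \<comment> \<open>As n \<ge> 1, the only positive multiple of \<open>p - 1\<close> in range
          is \<open>p - 1\<close> itself, which would force \<open>m = n\<close>.\<close>
        have "m + (p - 1 - n) < (p - 1) * 2" using m assms(3,4) by auto
        hence "j < 2" unfolding j by (simp only: mult_less_cancel1)
        moreover have "j \<noteq> 0" using j nz by (metis mult_0_right)
        ultimately have "j = 1" by simp
        thus False using j False assms(3,4) by simp
      qed
      hence "m + (p - 1 - n) = 0 \<or> \<not> (p - 1) dvd (m + (p - 1 - n))" by metis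
      from pcong_power_sum[OF this] False show ?thesis by (simp only: if_False)
    qed
  qed
  also have "(\<Sum>m<p. coeff q m * (if m = n then - 1 else 0)) = - coeff q n"
    using assms by (simp add: if_distrib[of "\<lambda>x. _ * x"] sum.delta cong: if_cong)
  finally show ?thesis .
qed

lemma pcong_legendre_sum_even:
  assumes "p > 3" "even n" "0 < n" "n < p"
  shows "pcong p 1 (legendre_sum n p)
           (- ((2 ^ (n + 1) + 4) / (of_nat n * 6 ^ n)) * bernoulli_poly (p - n) (1 / 3))"
proof -
  define r where "r = p - 1 - n"
  \<comment> \<open>Being even and positive, \<open>n\<close> is at least 2. Hence
    \<open>Suc (Suc r) < p\<close>, the bound under which the values of \<open>?B\<close> at
    \<open>p\<close>-integral points are \<open>p\<close>-integral.\<close>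
  have r: "p - n = Suc r" "Suc (Suc r) < p" "r + n = p - 1"
    using assms by (auto simp: r_def elim!: evenE)
  have odd: "odd p" using p assms prime_odd_nat by auto
  hence "even (r + n)" using assms by (simp add: r(3))
  hence "even r" using assms by simp
  have p3: "\<not> 3 dvd p" using p assms(1) by (auto simp: prime_nat_iff)
  have p2: "\<not> p dvd 2" "\<not> p dvd 3" using assms(1) by (auto dest: dvd_imp_le)
  have p6: "\<not> p dvd 6"
    using p2 p prime_dvd_mult_iff[of p 2 3] by simp
  let ?B = "bernoulli_poly (Suc r) :: rat \<Rightarrow> rat"
  \<comment> \<open>The values of G at 0, ..., p, continued to all indices with period 6.\<close>
  define h :: "nat \<Rightarrow> rat" where "h s = of_int ((-1) ^ s * Legendre (int p + int s) 3)" for s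
  let ?S = "\<Sum>s<p. h s * of_nat s ^ r"
  have per: "h (s + 6) = h s" for s
  proof -
    have "Legendre (int p + int (s + 6)) 3 = Legendre (int p + int s) 3"
      by (rule Legendre_3_cong) presburger
    thus ?thesis by (simp add: h_def power_add)
  qed
  \<comment> \<open>The shift by the odd \<open>p\<close> changes the sign of (-1)^a, and \<chi>(2p
    + a) = -\<chi>(a) - \<chi>(p + a); the terms with \<chi>(p + a) cancel, so the difference no
    longer depends on \<open>p\<close>.\<close>
  have diff: "h (a + p) - h a = of_int ((-1) ^ a * Legendre (int a) 3)" for a
  proof -
    have "\<not> 3 dvd int p" using p3 int_dvd_int_iff[of 3 p] by simp
    from Legendre_3_sum[OF this, of "int a"]
    have eq: "Legendre (int p + int (a + p)) 3 = - Legendre (int a) 3 - Legendre (int p + int a) 3"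
      by (simp add: algebra_simps)
    show ?thesis unfolding h_def eq using odd by (simp add: power_add algebra_simps)
  qed
  have h_int: "p_integral p (h a)" for a
    unfolding h_def by (rule p_integral_of_int)
  have p_integral_div6: "p_integral p (of_nat a / 6)" for a
    using p_integral_divide_of_nat[OF p_integral_of_nat p6] by simp
  have B_int: "p_integral p (?B (of_nat a / 6))" for a
    using p_integral_bernoulli_poly[OF p_integral_div6 r(2)] .

  have "pcong p 1 ?S (- coeff (legendre_poly p) n)"
    using pcong_coeff_via_power_sums[OF degree_legendre_poly p_integral_coeff_legendre_poly assms(3,4)]
      assms(1) by (simp add: h_def poly_legendre_poly_of_nat r_def)
  hence S: "pcong p 1 ?S (- legendre_sum n p)"
    using assms by (simp add: coeff_legendre_poly)

  have "of_nat (Suc r) * ?S =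
    6 ^ r * (\<Sum>a<6. h (a + p) * ?B (of_nat (a + p) / 6)) - 6 ^ r * (\<Sum>a<6. h a * ?B (of_nat a / 6))"
    using sum_periodic_power[of h 6 r p] per by simp
  also have "pcong p 1 \<dots>
    (6 ^ r * (\<Sum>a<6. h (a + p) * ?B (of_nat a / 6)) - 6 ^ r * (\<Sum>a<6. h a * ?B (of_nat a / 6)))"
  proof (intro pcong_diff pcong_mult_left pcong_sum pcong_refl h_int
      p_integral_power p_integral_numeral)
    fix a
    have eq: "(of_nat (a + p) / 6 - of_nat a / 6 :: rat) / of_nat p ^ 1 = of_nat 1 / 6"
      using assms(1) by (simp add: field_simps)
    have "pcong p 1 (of_nat (a + p) / 6) (of_nat a / 6)"
      unfolding pcong_def eq by (rule p_integral_div6)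
    thus "pcong p 1 (?B (of_nat (a + p) / 6)) (?B (of_nat a / 6))"
      by (rule pcong_bernoulli_poly[OF _ p_integral_div6 p_integral_div6 r(2)])
  qed
  also have "6 ^ r * (\<Sum>a<6. h (a + p) * ?B (of_nat a / 6)) - 6 ^ r * (\<Sum>a<6. h a * ?B (of_nat a / 6))
    = 6 ^ r * (\<Sum>a<6. (h (a + p) - h a) * ?B (of_nat a / 6))"
    by (simp add: algebra_simps sum_subtractf)
  also have "(\<Sum>a<6. (h (a + p) - h a) * ?B (of_nat a / 6)) =
             ?B (4 / 6) + ?B (5 / 6) - ?B (1 / 6) - ?B (2 / 6)"
    unfolding diff by (simp add: eval_nat_numeral Legendre_3)
  \<comment> \<open>The index \<open>Suc r\<close> is odd, so reflection sends the values at 5/6 and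
    2/3 to minus those at 1/6 and 1/3.\<close>
  also have "\<dots> = - 2 * (?B (1 / 6) + ?B (1 / 3))"
    using bernoulli_poly_reflect[of "Suc r" "1 / 6 :: rat"]
      bernoulli_poly_reflect[of "Suc r" "1 / 3 :: rat"] \<open>even r\<close> by simp
  also have "6 ^ r * \<dots> = - 2 * 3 ^ r * (2 ^ r * ?B (1 / 6) + 2 ^ r * ?B (1 / 3))"
    using power_mult_distrib[of 2 "3 :: rat" r] by (simp add: algebra_simps)
  \<comment> \<open>Duplication at 1/6 involves 1/6, 2/3 and 1/3; reflection removes 2/3.\<close>
  also have "2 ^ r * ?B (1 / 6) = (1 + 2 ^ r) * ?B (1 / 3)"
    using bernoulli_poly_double[of "Suc r" "1 / 6 :: rat"]
      bernoulli_poly_reflect[of "Suc r" "1 / 3 :: rat"] \<open>even r\<close> by (simp add: algebra_simps)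
  finally have T: "pcong p 1 (of_nat (Suc r) * ?S)
      (- 2 * 3 ^ r * ((1 + 2 ^ r) * ?B (1 / 3) + 2 ^ r * ?B (1 / 3)))" .

  \<comment> \<open>The factor clears the denominator of the claim. Then -n is replaced by p - n =
    \<open>Suc r\<close>, and \<open>6 ^ n\<close> completes \<open>3 ^ r\<close> and
    \<open>6 ^ r\<close> to powers with exponent p - 1, for Fermat's theorem.\<close>
  have "of_nat (n * 6 ^ n) * legendre_sum n p = 6 ^ n * (- of_nat n * - legendre_sum n p)" by simp
  also have "pcong p 1 \<dots> (6 ^ n * (of_nat (Suc r) * - legendre_sum n p))"
  proof -
    have "of_nat (Suc r) = (of_nat p - of_nat n :: rat)"
      unfolding r(1)[symmetric] using assms by (simp add: of_nat_diff)
    hence "pcong p 1 (- of_nat n) (of_nat (Suc r))"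
      using assms p_integral_uminus[OF p_integral_numeral(2)] by (simp add: pcong_def)
    hence "pcong p 1 (- of_nat n * - legendre_sum n p) (of_nat (Suc r) * - legendre_sum n p)"
      by (rule pcong_mult[OF _ pcong_refl p_integral_uminus[OF p_integral_legendre_sum] p_integral_of_nat])
    thus ?thesis by (intro pcong_mult_left p_integral_power p_integral_numeral)
  qed
  also have "pcong p 1 (6 ^ n * (of_nat (Suc r) * - legendre_sum n p)) (6 ^ n * (of_nat (Suc r) * ?S))"
    by (intro pcong_mult_left p_integral_power p_integral_numeral
          p_integral_of_nat pcong_sym[OF S])
  also have "pcong p 1 (6 ^ n * (of_nat (Suc r) * ?S))
     (6 ^ n * (- 2 * 3 ^ r * ((1 + 2 ^ r) * ?B (1 / 3) + 2 ^ r * ?B (1 / 3))))"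
    by (intro pcong_mult_left p_integral_power p_integral_numeral T)
  also have "\<dots> = (- (2 ^ (n + 1)) * ?B (1 / 3)) * 3 ^ (p - 1) + (- 4 * ?B (1 / 3)) * 6 ^ (p - 1)"
    unfolding r(3)[symmetric] power_add
    using power_mult_distrib[of 2 "3 :: rat" r] power_mult_distrib[of 2 "3 :: rat" n]
    by (simp add: algebra_simps)
  also have "pcong p 1 \<dots> ((- (2 ^ (n + 1)) * ?B (1 / 3)) * 1 + (- 4 * ?B (1 / 3)) * 1)"
  proof -
    have "p_integral p (?B (1 / 3))" using B_int[of 2] by simp
    thus ?thesis using pcong_fermat[OF p2(2)] pcong_fermat[OF p6]
      by (intro pcong_add pcong_mult_left p_integral_mult p_integral_uminus
            p_integral_power p_integral_numeral) auto
  qed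
  also have "\<dots> = of_nat (n * 6 ^ n) *
      (- ((2 ^ (n + 1) + 4) / (of_nat n * 6 ^ n)) * bernoulli_poly (p - n) (1 / 3))"
  proof -
    have "of_nat (n * 6 ^ n) * (- ((2 ^ (n + 1) + 4) / (of_nat n * 6 ^ n))) = (- (2 ^ (n + 1) + 4) :: rat)"
      using assms(3) by simp
    hence eq: "of_nat (n * 6 ^ n) * (- ((2 ^ (n + 1) + 4) / (of_nat n * 6 ^ n)) * ?B (1 / 3)) =
           - (2 ^ (n + 1) + 4) * ?B (1 / 3)"
      by (simp only: mult.assoc [symmetric])
    show ?thesis unfolding r(1) eq by (simp add: algebra_simps)
  qed
  finally show ?thesis
  proof (rule pcong_mult_cancel_of_nat)
    have "\<not> p dvd n" using nat_dvd_not_less assms(3,4) by blast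
    moreover have "\<not> p dvd 6 ^ n" using p6 prime_dvd_power[OF p] by blast
    ultimately show "\<not> p dvd n * 6 ^ n" by (simp only: prime_dvd_mult_iff[OF p] simp_thms)
  qed
qed

text \<open>In the coefficient of s^n in G(p - s), the contribution of \<open>m\<close> carries
  p^(m-n), so only \<open>m = n\<close> and \<open>m = Suc n\<close> survive modulo
  \<open>p ^ 2\<close>. For odd \<open>n\<close> the former enters as \<open>- g n\<close>, which
  doubles \<open>g n\<close> instead of cancelling it.\<close>

lemma pcong_2_legendre_sum_odd:
  assumes "odd p" "odd n" "Suc n < p"
  shows "pcong p 2 (2 * legendre_sum n p) (of_nat (Suc n) * of_nat p * legendre_sum (Suc n) p)"
proof -
  define g where "g = coeff (legendre_poly p)"
  have g: "p_integral p (g m)" for m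
    unfolding g_def by (rule p_integral_coeff_legendre_poly)
  have "g n = coeff (pcompose (legendre_poly p) [:of_nat p, -1:]) n"
    by (simp add: g_def legendre_poly_reflect assms)
  also have "\<dots> = (\<Sum>m\<le>p. g m * (of_nat (m choose n) * (-1) ^ n * of_nat p ^ (m - n)))"
    unfolding g_def using degree_legendre_poly[of p] assms
    by (intro coeff_pcompose_linear) auto
  also have "pcong p 2 \<dots> (\<Sum>m\<le>p. (if m = n then - g n else 0) +
      (if m = Suc n then - (of_nat (Suc n) * of_nat p * g (Suc n)) else 0))"
  proof (intro pcong_sum)
    fix m
    consider "m < n" | "m = n" | "m = Suc n" | j where "m = n + (2 + j)"
      by (metis add_2_eq_Suc less_natE less_antisym linorder_neqE_nat add_Suc_right add_Suc)
    thus "pcong p 2 (g m * (of_nat (m choose n) * (-1) ^ n * of_nat p ^ (m - n)))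
      ((if m = n then - g n else 0) +
      (if m = Suc n then - (of_nat (Suc n) * of_nat p * g (Suc n)) else 0))"
    proof cases
      case 4
      have "p_integral p (g m * (of_nat (m choose n) * of_int ((-1) ^ n) * of_nat (p ^ j)))"
        by (intro p_integral_mult g p_integral_of_nat p_integral_of_int)
      from pcong_0_mult[OF this, of 2] show ?thesis
        using 4 by (simp add: power_add power2_eq_square mult_ac)
    qed (use assms in \<open>simp_all add: pcong_refl binomial_eq_0 algebra_simps\<close>)
  qed
  also have "\<dots> = - g n - of_nat (Suc n) * of_nat p * g (Suc n)"
    using assms by (simp add: sum.distrib)
  finally have "pcong p 2 (g n) (- g n - of_nat (Suc n) * of_nat p * g (Suc n))" .
  from pcong_add[OF pcong_uminus[OF this] pcong_refl[of 2 "- g n"]]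
  have "pcong p 2 (2 * - g n) (of_nat (Suc n) * of_nat p * g (Suc n))" by simp
  moreover have "g n = - legendre_sum n p" "g (Suc n) = legendre_sum (Suc n) p"
    using assms by (auto simp: g_def coeff_legendre_poly odd_pos)
  ultimately show ?thesis by simp
qed

end

section \<open>The two parities combined\<close>

theorem theorem3p3:
  fixes n p :: nat
  assumes "n > 0" and "prime p" and "p > max (n + 1) 3"
  shows "(odd n \<longrightarrow>
           rat_cong_pow p 2 (legendre_sum n p)
             (- ((2 ^ (n + 1) + 2) / 6 ^ (n + 1)) * of_nat p * bernoulli_poly (p - n - 1) (1 / 3))) \<and>
         (even n \<longrightarrow>
           rat_cong_pow p 1 (legendre_sum n p)
             (- ((2 ^ (n + 1) + 4) / (of_nat n * 6 ^ n)) * bernoulli_poly (p - n) (1 / 3)))"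
proof -
  interpret prime_modulus p by unfold_locales (rule assms(2))
  have p3: "p > 3" "odd p" using assms prime_odd_nat by auto
  have p2: "\<not> p dvd 2" using p3 by (auto dest: dvd_imp_le)
  have "pcong p 2 (legendre_sum n p)
     (- ((2 ^ (n + 1) + 2) / 6 ^ (n + 1)) * of_nat p * bernoulli_poly (p - n - 1) (1 / 3))"
     (is "pcong p 2 _ ?R") if "odd n"
  proof -
    let ?R' = "- ((2 ^ (Suc n + 1) + 4) / (of_nat (Suc n) * 6 ^ Suc n)) *
      bernoulli_poly (p - Suc n) (1 / 3) :: rat"
    have "pcong p 1 (legendre_sum (Suc n) p) ?R'"
      using that assms by (intro pcong_legendre_sum_even[OF p3(1)]) auto
    from pcong_Suc_mult[OF this]
    have "pcong p 2 (of_nat p * legendre_sum (Suc n) p) (of_nat p * ?R')"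
      by (simp only: Suc_1)
    hence "pcong p 2 (of_nat (Suc n) * (of_nat p * legendre_sum (Suc n) p))
      (of_nat (Suc n) * (of_nat p * ?R'))"
      by (rule pcong_mult_left[OF _ p_integral_of_nat])
    moreover have "pcong p 2 (2 * legendre_sum n p) (of_nat (Suc n) * (of_nat p * legendre_sum (Suc n) p))"
      using pcong_2_legendre_sum_odd[OF p3(2) that] assms(3) by (simp add: mult.assoc)
    ultimately have "pcong p 2 (2 * legendre_sum n p) (of_nat (Suc n) * (of_nat p * ?R'))"
      using pcong_trans by blast
    \<comment> \<open>The factor n + 1 cancels the one in \<open>?R'\<close>, and 2^(n+2) + 4 is
      twice 2^(n+1) + 2; the remaining 2 is cancelled because \<open>p\<close> is odd.\<close>
    also have "of_nat (Suc n) * (of_nat p * ?R') = 2 * ?R"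
      by (simp add: field_simps del: of_nat_Suc)
    finally show ?thesis using pcong_mult_cancel_of_nat[of 2 2] p2 by simp
  qed
  moreover have "pcong p 1 (legendre_sum n p)
     (- ((2 ^ (n + 1) + 4) / (of_nat n * 6 ^ n)) * bernoulli_poly (p - n) (1 / 3))" if "even n"
    using pcong_legendre_sum_even[OF p3(1) that] assms by simp
  ultimately show ?thesis
    using pcong_imp_rat_cong_pow[OF p_integral_legendre_sum] by blast
qed

end
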